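(* Let $Y$ be a real topological vector space, $D\subset Y$ a non-trivial closed convex cone, and let $F\subset Y$ contain more than one element with $F\subseteq a-D$ for some $a\in Y$. Then $$\operatorname{Eff}(F,D)=\{y^0\in F\mid\exists k\in D\setminus(-D)\ \forall y\in F\setminus\{y^0\}:\ \varphi_{a-D,k}(y^0)<\varphi_{a-D,k}(y)\}.$$ For $y^0\in\operatorname{Eff}(F,D)$, one can choose $k=a-y^0$, which results in $\varphi_{a-D,k}(y^0)\le-1<\varphi_{a-D,k}(y)$ for all $y\in F\setminus\{y^0\}$, where $\varphi_{a-D,k}$ is proper.
   Context: $\operatorname{Eff}(F,D):=\{y^0\in F\mid F\cap(y^0-D)\subseteq\{y^0\}\}$. A set $C\subseteq Y$ is a cone if $\mathbb{R}_+C\subseteq C$ with $\mathbb{R}_+=\{x\in\mathbb{R}\mid x\ge0\}$; it is non-trivial if $C\neq\emptyset$, $C\neq\{0\}$, $C\neq Y$. For $a\in Y$ and $k\in D\setminus\{0\}$, $\varphi_{a-D,k}(y):=\inf\{t\in\mathbb{R}\mid y\in a-D+tk\}$ for $y\in Y$, where $\inf\emptyset:=\nu$ is a symbol outside the extended reals marking infeasibility; $\operatorname{dom}\varphi_{a-D,k}:=\{y\in Y\mid\varphi_{a-D,k}(y)\in\mathbb{R}\cup\{-\infty\}\}=a-D+\mathbb{R}k$ (which contains $F$ here, since $F\subseteq a-D$). $\varphi_{a-D,k}$ is called proper if $\operatorname{dom}\varphi_{a-D,k}\neq\emptyset$ and $\varphi_{a-D,k}(y)\in\mathbb{R}$ for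 all $y\in\operatorname{dom}\varphi_{a-D,k}$. *)

theory Defs
  imports "HOL-Analysis.Analysis"
begin

(* The scalar axiom is joint continuity at (r, a), in the same filter form as the
   tendsto_add_Pair axiom of topological_monoid_add. No separation axiom is assumed. *)
class real_topological_vector_space = real_vector + topological_ab_group_add +
  assumes tendsto_scaleR_Pair:
    "LIM x (nhds r \<times>\<^sub>F nhds a). fst x *\<^sub>R snd x :> nhds (r *\<^sub>R a)"

instance real_normed_vector \<subseteq> real_topological_vector_space
proof
  fix r :: real and a :: 'a
  show "LIM x (nhds r \<times>\<^sub>F nhds a). fst x *\<^sub>R snd x :> nhds (r *\<^sub>R a)"
    by (intro tendsto_scaleR filterlim_fst filterlim_snd)
qed

definition nontrivial_cone :: "'a::real_vector set \<Rightarrow> bool" where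
  "nontrivial_cone C \<longleftrightarrow> cone C \<and> C \<noteq> {} \<and> C \<noteq> {0} \<and> C \<noteq> UNIV"

definition Eff :: "'a::ab_group_add set \<Rightarrow> 'a set \<Rightarrow> 'a set" where
  "Eff F D = {y0 \<in> F. F \<inter> (\<lambda>d. y0 - d) ` D \<subseteq> {y0}}"

(* Extended reals with the additional symbol \<nu> for infeasibility: \<nu> is None.
   As \<nu> lies outside the extended reals, it is comparable with nothing; the order
   is therefore not the order on options, where None is the least element. *)
type_synonym ereal_nu = "ereal option"

definition le_nu :: "ereal_nu \<Rightarrow> ereal_nu \<Rightarrow> bool" (infix \<open>\<le>\<^sub>\<nu>\<close> 50) where
  "u \<le>\<^sub>\<nu> v \<longleftrightarrow> (\<exists>s t. u = Some s \<and> v = Some t \<and> s \<le> t)"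

definition less_nu :: "ereal_nu \<Rightarrow> ereal_nu \<Rightarrow> bool" (infix \<open><\<^sub>\<nu>\<close> 50) where
  "u <\<^sub>\<nu> v \<longleftrightarrow> (\<exists>s t. u = Some s \<and> v = Some t \<and> s < t)"

definition inf_nu :: "real set \<Rightarrow> ereal_nu" where
  "inf_nu T = (if T = {} then None else Some (Inf (ereal ` T)))"

definition phi :: "'a::real_vector set \<Rightarrow> 'a \<Rightarrow> 'a \<Rightarrow> ereal_nu" where
  "phi A k y = inf_nu {t. y \<in> (\<lambda>x. x + t *\<^sub>R k) ` A}"

definition dom_nu :: "('a \<Rightarrow> ereal_nu) \<Rightarrow> 'a set" where
  "dom_nu f = {y. f y = Some (-\<infinity>) \<or> (\<exists>r. f y = Some (ereal r))}"

definition proper_nu :: "('a \<Rightarrow> ereal_nu) \<Rightarrow> bool" where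
  "proper_nu f \<longleftrightarrow> dom_nu f \<noteq> {} \<and> (\<forall>y \<in> dom_nu f. \<exists>r. f y = Some (ereal r))"

end

theory Submission
  imports Defs
begin

text \<open>
  Write $\varphi_k$ for the functional with direction $k$. The value $\varphi_k(y)$ is the infimum of the times
  $t$ with $a - y + tk \in D$. When $k \in D$ these times form an up-set of reals, and since $D$ is
  closed a finite infimum is attained; hence $\varphi_k(y) \le s$ holds precisely when $a - y + sk \in D$
  (lemma \<open>phi_le_iff\<close>). So the sublevel sets of $\varphi_k$ are the translates of $a - D$
  along $k$, and both inclusions of the theorem become statements about membership in $D$.

  If $y^0$ is the strict minimiser of some $\varphi_k$ on $F$, it is efficient because
  $\varphi_k$ is monotone with respect to $D$ (lemma \<open>inf_nu_antimono\<close>): a point of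
  $y^0 - D$ has a value at most that of $y^0$, whenever the latter is not $\nu$.

  If $y^0$ is efficient, take $k = a - y^0$. The sublevel set at $-1$ is $a - D - k = y^0 - D$, which
  meets $F$ in $y^0$ only, so $\varphi_k \le -1$ singles out $y^0$ in $F$. This $k$ is not in
  $-D$: otherwise $a \in y^0 - D$, hence $F \subseteq a - D \subseteq y^0 - D$, and $F$ would be a
  singleton. Properness needs exactly $k \notin -D$: if $a - y + tk \in D$ for arbitrarily
  negative $t$, rescaling and passing to the limit in the closed cone $D$ puts $-k$ into $D$.
\<close>

lemma continuous_on_affine_line:
  fixes u v :: "'a::real_topological_vector_space"
  shows "continuous_on UNIV (\<lambda>s. u + s *\<^sub>R v)"
proof -
  have "((\<lambda>s. s *\<^sub>R v) \<longlongrightarrow> r *\<^sub>R v) (at r)" for r :: real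
  proof -
    have "LIM s at r. (s, v) :> nhds r \<times>\<^sub>F nhds v"
      by (intro filterlim_Pair tendsto_ident_at tendsto_const)
    from filterlim_compose[OF tendsto_scaleR_Pair this] show ?thesis
      by simp
  qed
  then have "continuous_on UNIV (\<lambda>s. s *\<^sub>R v)"
    by (simp add: continuous_on_def)
  then show ?thesis
    by (intro continuous_on_add continuous_on_const)
qed

lemma line_mem_closed_of_right_limit:
  fixes D :: "'a::real_topological_vector_space set"
  assumes "closed D" and "\<And>t. s < t \<Longrightarrow> u + t *\<^sub>R v \<in> D"
  shows "u + s *\<^sub>R v \<in> D"
proof -
  let ?T = "(\<lambda>t. u + t *\<^sub>R v) -` D"
  have "closed ?T"
    using assms(1) continuous_on_affine_line by (rule closed_vimage)
  moreover have "{s<..} \<subseteq> ?T"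
    using assms(2) by auto
  ultimately have "closure {s<..} \<subseteq> ?T"
    by (rule closure_minimal[rotated])
  then show ?thesis
    by auto
qed

lemma phi_reflected_cone:
  "phi ((\<lambda>d. a - d) ` D) k y = inf_nu {t. (a - y) + t *\<^sub>R k \<in> D}"
proof -
  have "y \<in> (\<lambda>x. x + t *\<^sub>R k) ` (\<lambda>d. a - d) ` D \<longleftrightarrow> (a - y) + t *\<^sub>R k \<in> D" for t
  proof
    assume "y \<in> (\<lambda>x. x + t *\<^sub>R k) ` (\<lambda>d. a - d) ` D"
    then show "(a - y) + t *\<^sub>R k \<in> D"
      by auto
  next
    assume mem: "(a - y) + t *\<^sub>R k \<in> D"
    have "y = (a - ((a - y) + t *\<^sub>R k)) + t *\<^sub>R k"
      by simp
    with mem show "y \<in> (\<lambda>x. x + t *\<^sub>R k) ` (\<lambda>d. a - d) ` D"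
      by blast
  qed
  then show ?thesis
    by (simp add: phi_def)
qed

text \<open>
  The hypothesis $S \neq \emptyset$ excludes the value $\nu$ on the right, which is comparable
  with nothing.
\<close>

lemma inf_nu_antimono:
  assumes "S \<subseteq> T" and "S \<noteq> {}"
  shows "inf_nu T \<le>\<^sub>\<nu> inf_nu S"
  using assms by (auto simp: inf_nu_def le_nu_def intro!: Inf_superset_mono)

text \<open>
  A finite infimum is attained: moving along $k \in D$ keeps a point in $D$, so every time
  strictly above the infimum is admissible, and closedness of $D$ adds the infimum itself. In
  particular a value $-\infty$ makes all times admissible.
\<close>

lemma phi_le_iff:
  fixes D :: "'a::real_topological_vector_space set"
  assumes "convex_cone D" "closed D" "k \<in> D"
  shows "phi ((\<lambda>d. a - d) ` D) k y \<le>\<^sub>\<nu> Some (ereal s) \<longleftrightarrow> (a - y) + s *\<^sub>R k \<in> D"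
proof
  let ?T = "{t. (a - y) + t *\<^sub>R k \<in> D}"
  assume "phi ((\<lambda>d. a - d) ` D) k y \<le>\<^sub>\<nu> Some (ereal s)"
  then have Inf_le: "Inf (ereal ` ?T) \<le> ereal s"
    by (auto simp: phi_reflected_cone inf_nu_def le_nu_def split: if_splits)
  show "(a - y) + s *\<^sub>R k \<in> D"
  proof (rule line_mem_closed_of_right_limit[OF \<open>closed D\<close>])
    fix r assume "s < r"
    with Inf_le have "Inf (ereal ` ?T) < ereal r"
      by (simp add: le_less_trans)
    then obtain t where t: "(a - y) + t *\<^sub>R k \<in> D" "t < r"
      by (auto simp: Inf_less_iff)
    have "(r - t) *\<^sub>R k \<in> D"
      using assms(1,3) t(2) by (simp add: convex_cone_scaleR)
    from convex_cone_add[OF assms(1) t(1) this] show "(a - y) + r *\<^sub>R k \<in> D"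
      by (simp add: algebra_simps)
  qed
next
  assume "(a - y) + s *\<^sub>R k \<in> D"
  then show "phi ((\<lambda>d. a - d) ` D) k y \<le>\<^sub>\<nu> Some (ereal s)"
    by (auto simp: phi_reflected_cone inf_nu_def le_nu_def intro!: Inf_lower)
qed

text \<open>
  The condition $-k \notin D$ keeps the functional above $-\infty$, and the point $a$, whose
  value is at most $0$, shows that the domain is nonempty.
\<close>

lemma phi_proper:
  fixes D :: "'a::real_topological_vector_space set"
  assumes D: "convex_cone D" "closed D" and k: "k \<in> D" "- k \<notin> D"
  shows "proper_nu (phi ((\<lambda>d. a - d) ` D) k)"
proof -
  let ?phi = "phi ((\<lambda>d. a - d) ` D) k"
  have not_MInf: "?phi y \<noteq> Some (-\<infinity>)" for y
  proof
    assume "?phi y = Some (-\<infinity>)"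
    then have all: "(a - y) + s *\<^sub>R k \<in> D" for s
      using phi_le_iff[OF D k(1), of a y s] by (simp add: le_nu_def)
    \<comment> \<open>Multiplying the admissible point at time $-1/t$ by $t$ gives the point $-k + t(a - y)$, which
      tends to $-k$ as $t$ decreases to $0$.\<close>
    have "- k + t *\<^sub>R (a - y) \<in> D" if "0 < t" for t
    proof -
      have "t *\<^sub>R ((a - y) + (- (1 / t)) *\<^sub>R k) \<in> D"
        using convex_cone_scaleR[OF D(1) less_imp_le[OF that] all] .
      then show ?thesis
        using that by (simp add: algebra_simps)
    qed
    then have "- k + 0 *\<^sub>R (a - y) \<in> D"
      by (rule line_mem_closed_of_right_limit[OF D(2)])
    with k(2) show False
      by simp
  qed
  have "0 \<in> D"
    using D(1) by (rule convex_cone_contains_0)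
  then have "?phi a \<le>\<^sub>\<nu> Some (ereal 0)"
    by (simp add: phi_le_iff[OF D k(1)])
  then obtain r where "?phi a = Some r" "r \<le> ereal 0"
    by (auto simp: le_nu_def)
  then have "a \<in> dom_nu ?phi"
    by (cases r) (auto simp: dom_nu_def)
  with not_MInf show ?thesis
    by (auto simp: proper_nu_def dom_nu_def)
qed

text \<open>
  Efficiency comes from monotonicity: if $y^0 - y \in D$, every time $t$ with
  $a - y^0 + tk \in D$ also satisfies $a - y + tk \in D$, by adding $y^0 - y$. A competitor $y$
  in $y^0 - D$ therefore cannot have a value above that of $y^0$.
\<close>

lemma strict_minimizer_phi_in_Eff:
  fixes D :: "'a::real_vector set"
  assumes "convex_cone D" "y0 \<in> F"
    and less: "\<And>y. y \<in> F - {y0} \<Longrightarrow>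
      phi ((\<lambda>d. a - d) ` D) k y0 <\<^sub>\<nu> phi ((\<lambda>d. a - d) ` D) k y"
  shows "y0 \<in> Eff F D"
proof -
  have "y0 - d = y0" if d: "d \<in> D" "y0 - d \<in> F" for d
  proof (rule ccontr)
    assume "y0 - d \<noteq> y0"
    with d have lt: "phi ((\<lambda>d. a - d) ` D) k y0 <\<^sub>\<nu> phi ((\<lambda>d. a - d) ` D) k (y0 - d)"
      by (intro less) simp
    let ?S = "{t. (a - y0) + t *\<^sub>R k \<in> D}"
    let ?T = "{t. (a - (y0 - d)) + t *\<^sub>R k \<in> D}"
    have "?S \<subseteq> ?T"
    proof
      fix t assume "t \<in> ?S"
      with d(1) have "((a - y0) + t *\<^sub>R k) + d \<in> D"
        using convex_cone_add[OF assms(1)] by blast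
      then show "t \<in> ?T"
        by (simp add: algebra_simps)
    qed
    moreover have "?S \<noteq> {}"
      using lt by (auto simp: phi_reflected_cone less_nu_def inf_nu_def split: if_splits)
    ultimately have "inf_nu ?T \<le>\<^sub>\<nu> inf_nu ?S"
      by (rule inf_nu_antimono)
    with lt show False
      by (auto simp: phi_reflected_cone less_nu_def le_nu_def)
  qed
  with \<open>y0 \<in> F\<close> show ?thesis
    by (auto simp: Eff_def)
qed

text \<open>
  If $y^0 - a \in D$, adding it to $a - y \in D$ puts every $y \in F$ into $y^0 - D$, so efficiency
  of $y^0$ would collapse $F$ to a single point.
\<close>

lemma Eff_direction_not_in_uminus:
  fixes D :: "'a::real_vector set"
  assumes "convex_cone D" "\<exists>x\<in>F. \<exists>y\<in>F. x \<noteq> y" "F \<subseteq> (\<lambda>d. a - d) ` D" "y0 \<in> Eff F D"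
  shows "- (a - y0) \<notin> D"
proof
  assume mem: "- (a - y0) \<in> D"
  have "y = y0" if "y \<in> F" for y
  proof -
    from that assms(3) have "a - y \<in> D"
      by auto
    from convex_cone_add[OF assms(1) mem this] have "y0 - y \<in> D"
      by simp
    then have "y0 - (y0 - y) \<in> (\<lambda>d. y0 - d) ` D"
      by (rule imageI)
    with that assms(4) show ?thesis
      by (auto simp: Eff_def)
  qed
  with assms(2) show False
    by blast
qed

theorem theorem9:
  fixes D F :: "'a::real_topological_vector_space set" and a :: 'a
  assumes "nontrivial_cone D" and "closed D" and "convex D"
    and "\<exists>x\<in>F. \<exists>y\<in>F. x \<noteq> y"
    and "F \<subseteq> (\<lambda>d. a - d) ` D"
  shows "Eff F D = {y0 \<in> F. \<exists>k \<in> D - uminus ` D. \<forall>y \<in> F - {y0}.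
            phi ((\<lambda>d. a - d) ` D) k y0 <\<^sub>\<nu> phi ((\<lambda>d. a - d) ` D) k y}
    \<and> (\<forall>y0 \<in> Eff F D.
          a - y0 \<in> D - uminus ` D
        \<and> phi ((\<lambda>d. a - d) ` D) (a - y0) y0 \<le>\<^sub>\<nu> Some (-1)
        \<and> (\<forall>y \<in> F - {y0}. Some (-1) <\<^sub>\<nu> phi ((\<lambda>d. a - d) ` D) (a - y0) y)
        \<and> proper_nu (phi ((\<lambda>d. a - d) ` D) (a - y0)))"
proof -
  have D: "convex_cone D" "closed D"
    using assms(1-3) by (auto simp: nontrivial_cone_def convex_cone_def conic_def cone_def)
  have "0 \<in> D"
    using D(1) by (rule convex_cone_contains_0)
  let ?phi = "phi ((\<lambda>d. a - d) ` D)"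
  have F: "a - y \<in> D" if "y \<in> F" for y
    using that assms(5) by auto
  have canonical: "a - y0 \<in> D - uminus ` D
      \<and> ?phi (a - y0) y0 \<le>\<^sub>\<nu> Some (-1)
      \<and> (\<forall>y \<in> F - {y0}. Some (-1) <\<^sub>\<nu> ?phi (a - y0) y)
      \<and> proper_nu (?phi (a - y0))" if y0: "y0 \<in> Eff F D" for y0
  proof (intro conjI ballI)
    from y0 have "y0 \<in> F"
      by (simp add: Eff_def)
    then have k: "a - y0 \<in> D"
      by (rule F)
    have nk: "- (a - y0) \<notin> D"
      using D(1) assms(4,5) y0 by (rule Eff_direction_not_in_uminus)
    show "a - y0 \<in> D - uminus ` D"
      using k nk by force
    have sublevel: "?phi (a - y0) y \<le>\<^sub>\<nu> Some (-1) \<longleftrightarrow> y0 - y \<in> D" for y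
      using phi_le_iff[OF D k, of a y "-1"] by (simp add: one_ereal_def)
    show "?phi (a - y0) y0 \<le>\<^sub>\<nu> Some (-1)"
      using \<open>0 \<in> D\<close> by (simp add: sublevel)
    show "proper_nu (?phi (a - y0))"
      using D k nk by (rule phi_proper)
    fix y assume y: "y \<in> F - {y0}"
    \<comment> \<open>Time $0$ is admissible because $F \subseteq a - D$, so the value at $y$ is not $\nu$, and
      failing to be at most $-1$ means being above $-1$.\<close>
    then have "?phi (a - y0) y \<le>\<^sub>\<nu> Some (ereal 0)"
      using F by (simp add: phi_le_iff[OF D k])
    moreover have "y0 - y \<notin> D"
    proof
      assume "y0 - y \<in> D"
      then have "y0 - (y0 - y) \<in> (\<lambda>d. y0 - d) ` D"
        by (rule imageI)
      with y y0 show False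
        by (auto simp: Eff_def)
    qed
    then have "\<not> ?phi (a - y0) y \<le>\<^sub>\<nu> Some (-1)"
      by (simp add: sublevel)
    ultimately show "Some (-1) <\<^sub>\<nu> ?phi (a - y0) y"
      by (auto simp: le_nu_def less_nu_def)
  qed
  have "Eff F D = {y0 \<in> F. \<exists>k \<in> D - uminus ` D. \<forall>y \<in> F - {y0}. ?phi k y0 <\<^sub>\<nu> ?phi k y}"
    (is "_ = ?R")
  proof
    show "Eff F D \<subseteq> ?R"
    proof
      fix y0 assume y0: "y0 \<in> Eff F D"
      have "?phi (a - y0) y0 <\<^sub>\<nu> ?phi (a - y0) y" if "y \<in> F - {y0}" for y
        using canonical[OF y0] that by (fastforce simp: le_nu_def less_nu_def)
      moreover have "y0 \<in> F"
        using y0 by (simp add: Eff_def)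
      ultimately show "y0 \<in> ?R"
        using canonical[OF y0] by blast
    qed
    show "?R \<subseteq> Eff F D"
      using strict_minimizer_phi_in_Eff[OF D(1)] by blast
  qed
  with canonical show ?thesis
    by blast
qed

end
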